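(* Let $D$ be a finite set, $Q$ a finite set of functions $q:D\to[-1,+1]$, $B:D\to\mathbb{N}$ a dataset with $n=\|B\|>0$, $T\in\mathbb{N}$ and $\epsilon>0$. Then with probability at least $1-2T/|Q|$, the output $A$ of MWEM (described in the context) on inputs $B,Q,T,\epsilon$ satisfies $$\max_{q\in Q}|q(A)-q(B)|\le 2n\sqrt{\frac{\log|D|}{T}}+\frac{10T\log|Q|}{\epsilon}.$$
   Context: $\|B\|=\sum_{x\in D}B(x)$. A query $q:D\to[-1,1]$ is extended to nonnegative weightings $A$ of $D$ by $q(A)=\sum_{x\in D}q(x)A(x)$. $\mathrm{Lap}(b)$ denotes a real random variable with density proportional to $\exp(-|z|/b)$. The Exponential Mechanism with parameter $\epsilon'$ and score $s$ on dataset $B$ outputs $q\in Q$ with probability proportional to $\exp(\epsilon' s(B,q)/2)$. MWEM: let $n=\|B\|$ and $A_0$ be $n$ times the uniform distribution on $D$. For $i=1,\dots,T$: (1) sample $q_i\in Q$ via the Exponential Mechanism with parameter $\epsilon/(2T)$ and score $s_i(B,q)=|q(A_{i-1})-q(B)|$; (2) let $m_i=q_i(B)+Z_i$, $Z_i\sim\mathrm{Lap}(2T/\epsilon)$ independent; (3) let $A_i$ be $n$ times the probability distribution on $D$ with $A_i(x)\propto A_{i-1}(x)\exp\big(q_i(x)(m_i-q_i(A_{i-1}))/(2n)\big)$. Output $A=\frac1T\sum_{i=0}^{T-1}A_i$. *)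

theory Defs
  imports "HOL-Probability.Probability"
begin

text \<open>
  A dataset is a function \<open>B :: 'a \<Rightarrow> nat\<close> of which only the values on \<open>D\<close> matter.  Weightings
  of \<open>D\<close> and queries on \<open>D\<close> are taken to be extensional (\<open>undefined\<close> outside \<open>D\<close>), so that two
  queries are equal iff they agree on \<open>D\<close> and \<open>card Q\<close> is the number of queries.
\<close>

definition dataset_size :: "'a set \<Rightarrow> ('a \<Rightarrow> nat) \<Rightarrow> nat" where
  "dataset_size D B = (\<Sum>x\<in>D. B x)"

definition query_value :: "'a set \<Rightarrow> ('a \<Rightarrow> real) \<Rightarrow> ('a \<Rightarrow> real) \<Rightarrow> real" where
  "query_value D q A = (\<Sum>x\<in>D. q x * A x)"

definition laplace_measure :: "real \<Rightarrow> real measure" where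
  "laplace_measure b = density lborel (\<lambda>z. ennreal (exp (- \<bar>z\<bar> / b) / (2 * b)))"

definition exponential_mechanism ::
  "real \<Rightarrow> ('d \<Rightarrow> 'q \<Rightarrow> real) \<Rightarrow> 'q set \<Rightarrow> 'd \<Rightarrow> 'q measure" where
  "exponential_mechanism e s Q B =
     point_measure Q (\<lambda>q. ennreal (exp (e * s B q / 2) / (\<Sum>q'\<in>Q. exp (e * s B q' / 2))))"

definition mwem_score ::
  "'a set \<Rightarrow> ('a \<Rightarrow> real) \<Rightarrow> ('a \<Rightarrow> nat) \<Rightarrow> ('a \<Rightarrow> real) \<Rightarrow> real" where
  "mwem_score D A B q = \<bar>query_value D q A - query_value D q (\<lambda>x. real (B x))\<bar>"

definition mwem_init :: "'a set \<Rightarrow> real \<Rightarrow> 'a \<Rightarrow> real" where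
  "mwem_init D n = (\<lambda>x\<in>D. n * (1 / real (card D)))"

definition mwem_update ::
  "'a set \<Rightarrow> real \<Rightarrow> ('a \<Rightarrow> real) \<Rightarrow> ('a \<Rightarrow> real) \<Rightarrow> real \<Rightarrow> 'a \<Rightarrow> real" where
  "mwem_update D n A q m =
     (let w = (\<lambda>x. A x * exp (q x * (m - query_value D q A) / (2 * n)))
      in (\<lambda>x\<in>D. n * (w x / (\<Sum>y\<in>D. w y))))"

abbreviation weighting_space :: "'a set \<Rightarrow> ('a \<Rightarrow> real) measure" where
  "weighting_space D \<equiv> (\<Pi>\<^sub>M x\<in>D. borel)"

abbreviation history_space :: "'a set \<Rightarrow> nat \<Rightarrow> (nat \<Rightarrow> 'a \<Rightarrow> real) measure" where
  "history_space D i \<equiv> (\<Pi>\<^sub>M j\<in>{..i}. weighting_space D)"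

text \<open>
  \<open>mwem_history D Q B T \<epsilon> i\<close> is the joint law of \<open>A\<^sub>0, \<dots>, A\<^sub>i\<close>.  Each round draws the query from
  the exponential mechanism and then fresh Laplace noise; the monadic bind is that of the Giry
  monad.
\<close>

primrec mwem_history ::
  "'a set \<Rightarrow> ('a \<Rightarrow> real) set \<Rightarrow> ('a \<Rightarrow> nat) \<Rightarrow> nat \<Rightarrow> real \<Rightarrow> nat \<Rightarrow> (nat \<Rightarrow> 'a \<Rightarrow> real) measure"
where
  "mwem_history D Q B T \<epsilon> 0 =
     return (history_space D 0) (\<lambda>j\<in>{..0}. mwem_init D (real (dataset_size D B)))"
| "mwem_history D Q B T \<epsilon> (Suc i) =
     do {
       A \<leftarrow> mwem_history D Q B T \<epsilon> i;
       q \<leftarrow> exponential_mechanism (\<epsilon> / (2 * real T)) (mwem_score D (A i)) Q B;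
       z \<leftarrow> laplace_measure (2 * real T / \<epsilon>);
       return (history_space D (Suc i))
         (A(Suc i := mwem_update D (real (dataset_size D B)) (A i) q
                       (query_value D q (\<lambda>x. real (B x)) + z)))
     }"

definition mwem ::
  "'a set \<Rightarrow> ('a \<Rightarrow> real) set \<Rightarrow> ('a \<Rightarrow> nat) \<Rightarrow> nat \<Rightarrow> real \<Rightarrow> ('a \<Rightarrow> real) measure" where
  "mwem D Q B T \<epsilon> =
     distr (mwem_history D Q B T \<epsilon> T) (weighting_space D)
       (\<lambda>A. \<lambda>x\<in>D. (1 / real T) * (\<Sum>i<T. A i x))"

text \<open>
  The bind of kernels that are not measurable is unspecified; the following lemmas show that all
  the kernels above are measurable and that \<open>mwem\<close> is a genuine probability measure.
\<close>

lemma prob_space_laplace_measure: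
  assumes "b > 0" shows "prob_space (laplace_measure b)"
proof
  let ?l = "1 / b"
  let ?g = "\<lambda>z. ennreal (exponential_density ?l z)"
  let ?f = "\<lambda>z. ennreal (exp (- \<bar>z\<bar> / b) / (2 * b))"
  have g[measurable]: "?g \<in> borel_measurable borel" by measurable
  have 1: "(\<integral>\<^sup>+z. ?g z \<partial>lborel) = 1"
    using prob_space.emeasure_space_1[OF prob_space_exponential_density[of ?l]] assms
    by (simp add: emeasure_density)
  have 2: "(\<integral>\<^sup>+z. ?g (- z) \<partial>lborel) = 1"
    using 1 nn_integral_real_affine[OF g, of "-1" 0] by simp
  have "?f z = ennreal (1/2) * (?g z + ?g (- z))" if "z \<noteq> 0" for z
  proof -
    have "exp (- \<bar>z\<bar> / b) / (2 * b) =
        1 / 2 * (exponential_density ?l z + exponential_density ?l (- z))"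
      using that assms by (auto simp: exponential_density_def field_simps)
    moreover have "0 \<le> exponential_density ?l x" for x
      using assms by (intro exponential_density_nonneg) simp
    ultimately show ?thesis
      by (metis add_nonneg_nonneg ennreal_mult ennreal_plus half_gt_zero_iff less_eq_real_def zero_less_one)
  qed
  then have "AE z in lborel. ?f z = ennreal (1/2) * (?g z + ?g (- z))"
    using AE_lborel_singleton[of "0::real"] by auto
  then have "(\<integral>\<^sup>+z. ?f z \<partial>lborel) = (\<integral>\<^sup>+z. ennreal (1/2) * (?g z + ?g (- z)) \<partial>lborel)"
    by (rule nn_integral_cong_AE)
  also have "\<dots> = ennreal (1/2) * (1 + 1)"
    by (subst nn_integral_cmult, measurable, subst nn_integral_add) (simp_all add: 1 2)
  also have "\<dots> = ennreal (1 / 2 * 2)" by (subst ennreal_mult) (simp_all add: one_add_one)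
  also have "\<dots> = 1" by simp
  finally show "emeasure (laplace_measure b) (space (laplace_measure b)) = 1"
    by (simp add: laplace_measure_def emeasure_density)
qed

lemma prob_space_exponential_mechanism:
  assumes "finite Q" "Q \<noteq> {}"
  shows "prob_space (exponential_mechanism e s Q B)"
proof
  have "(\<Sum>q\<in>Q. exp (e * s B q / 2)) > 0" using assms by (intro sum_pos) auto
  then show "emeasure (exponential_mechanism e s Q B) (space (exponential_mechanism e s Q B)) = 1"
    using assms
    by (simp add: exponential_mechanism_def space_point_measure emeasure_point_measure_finite
        sum_nonneg flip: sum_divide_distrib)
qed

lemma prob_kernel_exponential_mechanism:
  assumes "finite Q" "Q \<noteq> {}"
    and [measurable]: "\<And>q. q \<in> Q \<Longrightarrow> (\<lambda>x. s x B q) \<in> borel_measurable M"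
  shows "(\<lambda>x. exponential_mechanism e (s x) Q B) \<in> M \<rightarrow>\<^sub>M subprob_algebra (count_space Q)"
proof (rule measurable_subprob_algebra)
  show "subprob_space (exponential_mechanism e (s x) Q B)" for x
    by (intro prob_space_imp_subprob_space prob_space_exponential_mechanism assms)
  show "sets (exponential_mechanism e (s x) Q B) = sets (count_space Q)" for x
    by (simp add: exponential_mechanism_def sets_point_measure)
  fix X assume "X \<in> sets (count_space Q)"
  then have X: "X \<subseteq> Q" by simp
  have "(\<lambda>x. \<Sum>q\<in>X. ennreal (exp (e * s x B q / 2) / (\<Sum>q'\<in>Q. exp (e * s x B q' / 2))))
      \<in> borel_measurable M"
    using X by (intro borel_measurable_sum) (auto intro!: measurable_compose[OF _ measurable_ennreal] borel_measurable_divide borel_measurable_sum simp: subset_eq)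
  then show "(\<lambda>x. emeasure (exponential_mechanism e (s x) Q B) X) \<in> borel_measurable M"
    using X assms by (simp add: exponential_mechanism_def emeasure_point_measure_finite)
qed

lemma measurable_mwem_round:
  fixes D :: "'a set" and B :: "'a \<Rightarrow> nat" and i T :: nat and \<epsilon> :: real
  assumes D: "finite D" and Q: "finite Q" "Q \<noteq> {}" and b: "2 * real T / \<epsilon> > 0"
  defines "K \<equiv> \<lambda>A. do {
       q \<leftarrow> exponential_mechanism (\<epsilon> / (2 * real T)) (mwem_score D (A i)) Q B;
       z \<leftarrow> laplace_measure (2 * real T / \<epsilon>);
       return (history_space D (Suc i))
         (A(Suc i := mwem_update D (real (dataset_size D B)) (A i) q
                       (query_value D q (\<lambda>x. real (B x)) + z)))
     }"
  shows "K \<in> history_space D i \<rightarrow>\<^sub>M subprob_algebra (history_space D (Suc i))"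
    and "\<And>A. A \<in> space (history_space D i) \<Longrightarrow> prob_space (K A)"
proof -
  let ?H = "history_space D i" and ?n = "real (dataset_size D B)"
  let ?L = "laplace_measure (2 * real T / \<epsilon>)"
  interpret L: prob_space ?L by (rule prob_space_laplace_measure[OF b])
  have sL[measurable_cong]: "sets ?L = sets borel" by (simp add: laplace_measure_def)
  have Ai[measurable]: "(\<lambda>A. A i) \<in> ?H \<rightarrow>\<^sub>M weighting_space D"
    by (rule measurable_component_singleton) simp
  have Aix: "(\<lambda>A. A i x) \<in> borel_measurable ?H" if "x \<in> D" for x
    using measurable_compose[OF Ai measurable_component_singleton[OF that]] .
  have qv: "(\<lambda>A. query_value D q (A i)) \<in> borel_measurable ?H" for q
    unfolding query_value_def using Aix by (intro borel_measurable_sum) auto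
  have E: "(\<lambda>A. exponential_mechanism (\<epsilon> / (2 * real T)) (mwem_score D (A i)) Q B)
      \<in> ?H \<rightarrow>\<^sub>M subprob_algebra (count_space Q)"
    unfolding mwem_score_def
    by (rule prob_kernel_exponential_mechanism[where s="\<lambda>A B q. \<bar>query_value D q (A i) - query_value D q (\<lambda>x. real (B x))\<bar>"])
      (use Q qv in auto)
  have upd: "(\<lambda>(A, z). mwem_update D ?n (A i) q (query_value D q (\<lambda>x. real (B x)) + z))
      \<in> ?H \<Otimes>\<^sub>M borel \<rightarrow>\<^sub>M weighting_space D" for q
  proof -
    have [measurable]: "(\<lambda>p. fst p i x) \<in> borel_measurable (?H \<Otimes>\<^sub>M borel)" if "x \<in> D" for x
      using measurable_compose[OF measurable_fst Aix[OF that]] .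
    have [measurable]: "(\<lambda>p. query_value D q (fst p i)) \<in> borel_measurable (?H \<Otimes>\<^sub>M borel)"
      using measurable_compose[OF measurable_fst qv] .
    show ?thesis unfolding mwem_update_def Let_def split_beta
      by (intro measurable_restrict borel_measurable_times borel_measurable_divide borel_measurable_sum) measurable
  qed
  have ret: "(\<lambda>p. return (history_space D (Suc i)) ((fst (fst p))(Suc i := mwem_update D ?n (fst (fst p) i) (snd (fst p)) (query_value D (snd (fst p)) (\<lambda>x. real (B x)) + snd p))))
      \<in> (?H \<Otimes>\<^sub>M count_space Q) \<Otimes>\<^sub>M ?L \<rightarrow>\<^sub>M subprob_algebra (history_space D (Suc i))"
  proof (rule measurable_compose[OF _ return_measurable], rule measurable_fun_upd[where J="{..i}"])
    show "(\<lambda>x. fst (fst x)) \<in> (?H \<Otimes>\<^sub>M count_space Q) \<Otimes>\<^sub>M ?L \<rightarrow>\<^sub>M ?H" by measurable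
    let ?f = "\<lambda>(q, p). mwem_update D ?n (fst p i) q (query_value D q (\<lambda>x. real (B x)) + snd p)"
    have f: "?f \<in> count_space Q \<Otimes>\<^sub>M (?H \<Otimes>\<^sub>M borel) \<rightarrow>\<^sub>M weighting_space D"
      using upd by (intro measurable_pair_measure_countable1)
        (auto simp: Q countable_finite split_beta)
    have "(\<lambda>p. (snd (fst p), (fst (fst p), snd p))) \<in> (?H \<Otimes>\<^sub>M count_space Q) \<Otimes>\<^sub>M ?L \<rightarrow>\<^sub>M count_space Q \<Otimes>\<^sub>M (?H \<Otimes>\<^sub>M borel)"
      by measurable
    from measurable_compose[OF this f]
    show "(\<lambda>p. mwem_update D ?n (fst (fst p) i) (snd (fst p)) (query_value D (snd (fst p)) (\<lambda>x. real (B x)) + snd p))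
      \<in> (?H \<Otimes>\<^sub>M count_space Q) \<Otimes>\<^sub>M ?L \<rightarrow>\<^sub>M weighting_space D" by simp
  qed auto
  have Lc: "(\<lambda>_. ?L) \<in> N \<rightarrow>\<^sub>M subprob_algebra ?L" for N
    by (intro measurable_const L.M_in_subprob)
  have inner: "(\<lambda>p. ?L \<bind> (\<lambda>z. return (history_space D (Suc i)) ((fst p)(Suc i := mwem_update D ?n (fst p i) (snd p) (query_value D (snd p) (\<lambda>x. real (B x)) + z)))))
     \<in> ?H \<Otimes>\<^sub>M count_space Q \<rightarrow>\<^sub>M subprob_algebra (history_space D (Suc i))"
    using ret by (intro measurable_bind[OF Lc]) simp
  show "K \<in> history_space D i \<rightarrow>\<^sub>M subprob_algebra (history_space D (Suc i))"
    unfolding K_def by (rule measurable_bind[OF E inner])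
  fix A assume A: "A \<in> space ?H"
  interpret E: prob_space "exponential_mechanism (\<epsilon> / (2 * real T)) (mwem_score D (A i)) Q B"
    by (rule prob_space_exponential_mechanism[OF Q])
  have sE: "sets (exponential_mechanism (\<epsilon> / (2 * real T)) (mwem_score D (A i)) Q B) = sets (count_space Q)"
    using sets_kernel[OF E A] .
  have i1: "(\<lambda>q. ?L \<bind> (\<lambda>z. return (history_space D (Suc i)) (A(Suc i := mwem_update D ?n (A i) q (query_value D q (\<lambda>x. real (B x)) + z)))))
     \<in> count_space Q \<rightarrow>\<^sub>M subprob_algebra (history_space D (Suc i))"
    using measurable_compose[OF measurable_Pair1'[OF A] inner] by simp
  have r1: "(\<lambda>z. A(Suc i := mwem_update D ?n (A i) q (query_value D q (\<lambda>x. real (B x)) + z))) \<in> ?L \<rightarrow>\<^sub>M history_space D (Suc i)" if "q \<in> Q" for q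
  proof (rule measurable_fun_upd[where J="{..i}"])
    show "(\<lambda>z. mwem_update D ?n (A i) q (query_value D q (\<lambda>x. real (B x)) + z)) \<in> ?L \<rightarrow>\<^sub>M weighting_space D"
      using measurable_compose[OF measurable_Pair1'[OF A] upd[of q]] by (simp add: measurable_cong_sets[OF sL refl])
  qed (use A in \<open>auto intro: measurable_const\<close>)
  show "prob_space (K A)" unfolding K_def
  proof (rule E.prob_space_bind[where S="history_space D (Suc i)"])
    show "AE q in exponential_mechanism (\<epsilon> / (2 * real T)) (mwem_score D (A i)) Q B. prob_space (?L \<bind> (\<lambda>z. return (history_space D (Suc i)) (A(Suc i := mwem_update D ?n (A i) q (query_value D q (\<lambda>x. real (B x)) + z)))))"
    proof (rule AE_I2)
      fix q assume "q \<in> space (exponential_mechanism (\<epsilon> / (2 * real T)) (mwem_score D (A i)) Q B)"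
      then have q: "q \<in> Q" by (simp add: exponential_mechanism_def space_point_measure)
      show "prob_space (?L \<bind> (\<lambda>z. return (history_space D (Suc i)) (A(Suc i := mwem_update D ?n (A i) q (query_value D q (\<lambda>x. real (B x)) + z)))))"
        by (subst bind_return_distr'[OF L.not_empty r1[OF q]]) (rule L.prob_space_distr[OF r1[OF q]])
    qed
  qed (unfold measurable_cong_sets[OF sE refl], rule i1)
qed

lemma mwem_history_wf:
  assumes D: "finite D" and Q: "finite Q" "Q \<noteq> {}" and T: "T > 0" "\<epsilon> > 0"
  shows "prob_space (mwem_history D Q B T \<epsilon> i) \<and> sets (mwem_history D Q B T \<epsilon> i) = sets (history_space D i)"
proof (induction i)
  case 0
  have "mwem_init D n \<in> space (weighting_space D)" for n
    by (auto simp: space_PiM mwem_init_def)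
  then show ?case by (auto intro!: prob_space_return simp: space_PiM PiE_iff)
next
  case (Suc i)
  then interpret H: prob_space "mwem_history D Q B T \<epsilon> i" by simp
  have s: "sets (mwem_history D Q B T \<epsilon> i) = sets (history_space D i)" using Suc by simp
  have b: "2 * real T / \<epsilon> > 0" using T by simp
  note m = measurable_mwem_round[OF D Q b, where i=i and B=B]
  note sp = sets_eq_imp_space_eq[OF s]
  show ?case unfolding mwem_history.simps
  proof
    show "prob_space (mwem_history D Q B T \<epsilon> i \<bind> (\<lambda>A. do {
       q \<leftarrow> exponential_mechanism (\<epsilon> / (2 * real T)) (mwem_score D (A i)) Q B;
       z \<leftarrow> laplace_measure (2 * real T / \<epsilon>);
       return (history_space D (Suc i))
         (A(Suc i := mwem_update D (real (dataset_size D B)) (A i) q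
                       (query_value D q (\<lambda>x. real (B x)) + z)))
     }))"
      by (rule H.prob_space_bind[where S="history_space D (Suc i)"])
         (use m sp in \<open>auto simp: measurable_cong_sets[OF s refl]\<close>)
    show "sets (mwem_history D Q B T \<epsilon> i \<bind> (\<lambda>A. do {
       q \<leftarrow> exponential_mechanism (\<epsilon> / (2 * real T)) (mwem_score D (A i)) Q B;
       z \<leftarrow> laplace_measure (2 * real T / \<epsilon>);
       return (history_space D (Suc i))
         (A(Suc i := mwem_update D (real (dataset_size D B)) (A i) q
                       (query_value D q (\<lambda>x. real (B x)) + z)))
     })) = sets (history_space D (Suc i))"
      by (rule sets_bind[OF _ H.not_empty]) (rule sets_kernel[OF m(1)], simp add: sp)
  qed
qed

lemma prob_space_mwem:
  assumes D: "finite D" and Q: "finite Q" "Q \<noteq> {}" and T: "T > 0" "\<epsilon> > 0"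
  shows "prob_space (mwem D Q B T \<epsilon>)"
proof -
  interpret H: prob_space "mwem_history D Q B T \<epsilon> T" using mwem_history_wf[OF assms] by simp
  have s: "sets (mwem_history D Q B T \<epsilon> T) = sets (history_space D T)" using mwem_history_wf[OF assms] by simp
  have "(\<lambda>A. A i x) \<in> borel_measurable (history_space D T)" if "x \<in> D" "i < T" for x i
    using that by (intro measurable_compose[where N="weighting_space D" and f="\<lambda>A. A i" and g="\<lambda>a. a x"]
      measurable_component_singleton) auto
  then show ?thesis unfolding mwem_def
    by (intro H.prob_space_distr measurable_restrict borel_measurable_times borel_measurable_sum)
      (auto simp: measurable_cong_sets[OF s refl])
qed

end

theory Submission
  imports Defs
begin

text \<open>
  The potential is the cross entropy of the normalised dataset relative to the current weighting.
  It starts at \<open>ln |D|\<close>, stays nonnegative, and by Hoeffding's lemma each round lowers it by at least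
  \<open>(s\<^sup>2 - z\<^sup>2) / 4n\<^sup>2\<close>, where \<open>s\<close> is the score of the selected query and \<open>z\<close> the Laplace noise.  With
  \<open>c = 2T ln |Q| / \<epsilon>\<close>, except with probability \<open>1/|Q|\<close> each, the noise in a round is at most \<open>c\<close> and the
  selected score is within \<open>4c\<close> of the maximal one.  Telescoping the potential and the
  Cauchy-Schwarz inequality then bound the mean of the selected scores by
  \<open>2n sqrt (ln |D| / T) + c\<close>.
\<close>

section \<open>Moment, tail and failure estimates for a single random draw\<close>

text \<open>The weights \<open>a\<close> form a probability distribution on \<open>D\<close>, so
  this is Hoeffding's lemma for a variable in \<open>[-1, 1]\<close>. Both signs of \<open>l\<close>
  matter, because the exponent of an update has the sign of the noisy error.\<close>

lemma hoeffding_weighted_exp: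
  fixes a q :: "'a \<Rightarrow> real"
  assumes fin: "finite D" and a: "\<And>x. x \<in> D \<Longrightarrow> 0 \<le> a x" "(\<Sum>x\<in>D. a x) = 1"
    and q: "\<And>x. x \<in> D \<Longrightarrow> q x \<in> {-1..1}"
  shows "(\<Sum>x\<in>D. a x * exp (l * q x)) \<le> exp (l * (\<Sum>x\<in>D. a x * q x) + l\<^sup>2 / 2)"
proof -
  \<comment> \<open>Hoeffding's lemma is applied for positive \<open>l\<close> only. The claim is
    kept general in \<open>q\<close> so that negative \<open>l\<close> follows by replacing
    \<open>l\<close>, \<open>q\<close> with \<open>- l\<close>, \<open>- q\<close>.\<close>
  have pos: "(\<Sum>x\<in>D. a x * exp (l * q x)) \<le> exp (l * (\<Sum>x\<in>D. a x * q x) + l\<^sup>2 / 2)"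
    if l: "l > 0" and q: "\<And>x. x \<in> D \<Longrightarrow> q x \<in> {-1..1}" for l and q :: "'a \<Rightarrow> real"
  proof -
    let ?M = "point_measure D (\<lambda>x. ennreal (a x))"
    interpret prob_space ?M
      by standard (simp add: space_point_measure emeasure_point_measure_finite fin a)
    interpret interval_bounded_random_variable ?M q "-1" 1
      by standard (use q in \<open>auto intro!: AE_I2 simp: space_point_measure\<close>)
    define \<mu> where "\<mu> = (\<Sum>x\<in>D. a x * q x)"
    have E: "expectation q = \<mu>"
      using fin a by (simp add: lebesgue_integral_point_measure_finite \<mu>_def)
    have "ennreal (\<Sum>x\<in>D. a x * exp (l * (q x - \<mu>))) = (\<integral>\<^sup>+x. exp (l * (q x - expectation q)) \<partial>?M)"
      using fin a by (simp add: nn_integral_point_measure_finite E sum_nonneg ennreal_mult flip: sum_ennreal)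
    \<comment> \<open>The interval has width 2, and \<open>2^2 / 8 = 1 / 2\<close>.\<close>
    also have "\<dots> \<le> ennreal (exp (l\<^sup>2 / 2))"
      using Hoeffdings_lemma_nn_integral[OF l] by simp
    finally have "(\<Sum>x\<in>D. a x * exp (l * (q x - \<mu>))) \<le> exp (l\<^sup>2 / 2)"
      by simp
    then have "exp (l * \<mu>) * (\<Sum>x\<in>D. a x * exp (l * (q x - \<mu>))) \<le> exp (l * \<mu>) * exp (l\<^sup>2 / 2)"
      by simp
    moreover have "exp (l * \<mu>) * (a x * exp (l * (q x - \<mu>))) = a x * exp (l * q x)" for x
      by (simp add: algebra_simps exp_diff)
    ultimately show ?thesis
      unfolding exp_add \<mu>_def[symmetric] by (simp add: sum_distrib_left)
  qed
  consider "l > 0" | "l = 0" | "- l > 0" by linarith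
  then show ?thesis
  proof cases
    case 1 then show ?thesis using pos[OF 1 q] by simp
  next
    case 2 then show ?thesis using a by simp
  next
    case 3 then show ?thesis using pos[OF 3, of "\<lambda>x. - q x"] q by (fastforce simp: sum_negf)
  qed
qed

text \<open>The Laplace density is the average of an exponential density and its mirror image. Both
  halves contribute equally, so the two-sided tail equals the one-sided exponential tail.\<close>

lemma laplace_tail:
  assumes b: "b > 0" and c: "c \<ge> 0"
  shows "emeasure (laplace_measure b) {z. \<bar>z\<bar> > c} = ennreal (exp (- c / b))"
proof -
  let ?g = "\<lambda>z. ennreal (exponential_density (1 / b) z)"
  let ?I = "indicator {z::real. \<bar>z\<bar> > c} :: real \<Rightarrow> ennreal"
  have dens: "ennreal (exp (- \<bar>z\<bar> / b) / (2 * b)) * ?I z = ennreal (1/2) * (?g z * ?I z + ?g (- z) * ?I (- z))"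
    if "z \<noteq> 0" for z
  proof -
    \<comment> \<open>At 0 both one-sided densities equal \<open>1 / b\<close>, twice the value
      required of their sum; hence the restriction to \<open>z\<close> other than 0, which loses
      only a null set.\<close>
    have "exp (- \<bar>z\<bar> / b) / (2 * b) =
        1 / 2 * (exponential_density (1 / b) z + exponential_density (1 / b) (- z))"
      using that b by (auto simp: exponential_density_def field_simps)
    moreover have "0 \<le> exponential_density (1 / b) x" for x
      using b by (intro exponential_density_nonneg) simp
    ultimately have "ennreal (exp (- \<bar>z\<bar> / b) / (2 * b)) = ennreal (1/2) * (?g z + ?g (- z))"
      by (metis add_nonneg_nonneg ennreal_mult ennreal_plus half_gt_zero_iff less_eq_real_def zero_less_one)
    then show ?thesis by (simp split: split_indicator)
  qed
  interpret E: prob_space "density lborel (exponential_density (1 / b))"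
    using b by (intro prob_space_exponential_density) simp
  have "distributed (density lborel (exponential_density (1 / b))) lborel (\<lambda>x. x) (exponential_density (1 / b))"
    unfolding distributed_def by (auto simp: distr_id2 intro: sym)
  from E.exponential_distributedD_gt[OF this c] b
  have "emeasure (density lborel (exponential_density (1 / b))) {z. z > c} = ennreal (exp (- c / b))"
    by (simp add: E.emeasure_eq_measure)
  moreover have "?g z * ?I z = ?g z * indicator {z. z > c} z" for z
    using c by (auto simp: exponential_density_def split: split_indicator)
  ultimately have half: "(\<integral>\<^sup>+z. ?g z * ?I z \<partial>lborel) = ennreal (exp (- c / b))"
    by (simp add: emeasure_density)
  then have half': "(\<integral>\<^sup>+z. ?g (- z) * ?I (- z) \<partial>lborel) = ennreal (exp (- c / b))"
    using nn_integral_real_affine[of "\<lambda>z. ?g z * ?I z" "-1" 0] by simp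
  have "emeasure (laplace_measure b) {z. \<bar>z\<bar> > c} =
      (\<integral>\<^sup>+z. ennreal (exp (- \<bar>z\<bar> / b) / (2 * b)) * ?I z \<partial>lborel)"
    by (simp add: laplace_measure_def emeasure_density)
  also have "\<dots> = (\<integral>\<^sup>+z. ennreal (1/2) * (?g z * ?I z + ?g (- z) * ?I (- z)) \<partial>lborel)"
    by (intro nn_integral_cong_AE eventually_mono[OF AE_lborel_singleton[of "0::real"]] dens)
  also have "\<dots> = ennreal (1/2) * (ennreal (exp (- c / b)) + ennreal (exp (- c / b)))"
    by (subst nn_integral_cmult, measurable, subst nn_integral_add) (simp_all add: half half')
  also have "\<dots> = ennreal (1/2 * (exp (- c / b) + exp (- c / b)))"
    by (simp only: ennreal_mult ennreal_plus exp_ge_zero add_nonneg_nonneg zero_le_divide_1_iff zero_le_numeral)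
  also have "\<dots> = ennreal (exp (- c / b))" by simp
  finally show ?thesis .
qed

text \<open>The normalising sum is at least the term of any better query, so a query beaten by more
  than \<open>r\<close> has probability at most \<open>exp (- e * r / 2)\<close>. A union bound over
  at most \<open>card Q\<close> such queries finishes.\<close>

lemma exponential_mechanism_bad:
  assumes Q: "finite Q" "Q \<noteq> {}" and e: "e \<ge> 0"
  shows "emeasure (exponential_mechanism e s Q B) {q \<in> Q. \<exists>q'\<in>Q. s B q' > s B q + r}
    \<le> ennreal (real (card Q) * exp (- e * r / 2))"
proof -
  let ?S = "\<Sum>q\<in>Q. exp (e * s B q / 2)" and ?X = "{q \<in> Q. \<exists>q'\<in>Q. s B q' > s B q + r}"
  have le: "exp (e * s B q / 2) / ?S \<le> exp (- e * r / 2)" if q: "q \<in> ?X" for q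
  proof -
    obtain q' where q': "q' \<in> Q" "s B q' > s B q + r" using q by blast
    have "exp (e * s B q' / 2) \<le> ?S"
      using q' Q by (intro member_le_sum) auto
    moreover have "e * (s B q + r) \<le> e * s B q'"
      using q' e by (intro mult_left_mono) auto
    ultimately have "exp (e * s B q / 2 + e * r / 2) \<le> ?S"
      by (smt (verit) exp_le_cancel_iff field_sum_of_halves distrib_left add_divide_distrib divide_right_mono)
    then have "exp (- e * r / 2) * exp (e * s B q / 2 + e * r / 2) \<le> exp (- e * r / 2) * ?S"
      by (intro mult_left_mono) auto
    then have "exp (e * s B q / 2) \<le> exp (- e * r / 2) * ?S"
      by (simp flip: exp_add)
    moreover have "?S > 0" using Q by (intro sum_pos) auto
    ultimately show ?thesis by (simp add: divide_le_eq)
  qed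
  have S: "?S > 0" using Q by (intro sum_pos) auto
  have "emeasure (exponential_mechanism e s Q B) ?X = ennreal (\<Sum>q\<in>?X. exp (e * s B q / 2) / ?S)"
    using Q S by (simp add: exponential_mechanism_def emeasure_point_measure_finite sum_ennreal sum_nonneg)
  also have "(\<Sum>q\<in>?X. exp (e * s B q / 2) / ?S) \<le> real (card ?X) * exp (- e * r / 2)"
    by (rule sum_bounded_above[OF le])
  also have "\<dots> \<le> real (card Q) * exp (- e * r / 2)"
    using Q by (intro mult_right_mono of_nat_mono card_mono) auto
  finally show ?thesis by (simp add: ennreal_leI)
qed

text \<open>Union bound for a two-stage experiment: on \<open>Y\<close> the second stage is bounded
  by 1, off \<open>Y\<close> by \<open>p\<close>. It serves both within a round (\<open>Y\<close>:
  poorly chosen queries) and across rounds (\<open>Y\<close>: bad histories).\<close>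

lemma emeasure_bind_le:
  assumes "prob_space M" and K: "K \<in> M \<rightarrow>\<^sub>M subprob_algebra N" and X: "X \<in> sets N" and Y: "Y \<in> sets M"
    and le: "\<And>x. x \<in> space M \<Longrightarrow> x \<notin> Y \<Longrightarrow> emeasure (K x) X \<le> p"
  shows "emeasure (M \<bind> K) X \<le> emeasure M Y + p"
proof -
  interpret M: prob_space M by fact
  have "emeasure (M \<bind> K) X = (\<integral>\<^sup>+x. emeasure (K x) X \<partial>M)"
    by (rule emeasure_bind[OF M.not_empty K X])
  also have "\<dots> \<le> (\<integral>\<^sup>+x. indicator Y x + p \<partial>M)"
  proof (rule nn_integral_mono)
    fix x assume x: "x \<in> space M"
    have "emeasure (K x) X \<le> 1"
      using measurable_space[OF K x] by (auto simp: space_subprob_algebra intro: subprob_space.subprob_emeasure_le_1)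
    then show "emeasure (K x) X \<le> indicator Y x + p"
      using le[OF x] by (auto split: split_indicator intro: add_increasing2)
  qed
  also have "\<dots> = emeasure M Y + p"
    using Y by (simp add: nn_integral_add M.emeasure_space_1)
  finally show ?thesis .
qed

section \<open>The potential and its decrease in one update\<close>

locale mwem_run =
  fixes D :: "'a set" and Q :: "('a \<Rightarrow> real) set" and B :: "'a \<Rightarrow> nat"
    and n T :: nat and \<epsilon> :: real
  assumes D: "finite D" and Q: "finite Q" "Q \<noteq> {}" "Q \<subseteq> D \<rightarrow>\<^sub>E {-1..1}"
    and n: "n = dataset_size D B" "n > 0" and T: "T > 0" and \<epsilon>: "\<epsilon> > 0"
begin

abbreviation qval :: "('a \<Rightarrow> real) \<Rightarrow> ('a \<Rightarrow> real) \<Rightarrow> real" where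
  "qval \<equiv> query_value D"

abbreviation Bval :: "('a \<Rightarrow> real) \<Rightarrow> real" where
  "Bval q \<equiv> qval q (\<lambda>x. real (B x))"

abbreviation err :: "('a \<Rightarrow> real) \<Rightarrow> ('a \<Rightarrow> real) \<Rightarrow> real" where
  "err A q \<equiv> mwem_score D A B q"

text \<open>
  The entropy of \<open>B\<close>, constant throughout a run, is left out of the relative entropy, so
  nonnegativity only needs \<open>A x \<le> n\<close>.
\<close>

definition potential :: "('a \<Rightarrow> real) \<Rightarrow> real" where
  "potential A = - (\<Sum>x\<in>D. B x / n * ln (A x / n))"

text \<open>Positivity allows the logarithms in \<open>potential\<close> to be split, and total mass
  \<open>n\<close> makes \<open>A x / n\<close> a probability distribution, as Hoeffding's lemma
  requires.\<close>

definition valid :: "('a \<Rightarrow> real) \<Rightarrow> bool" where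
  "valid A \<longleftrightarrow> (\<forall>x\<in>D. 0 < A x) \<and> (\<Sum>x\<in>D. A x) = n"

lemma D_nonempty: "D \<noteq> {}"
  using n by (auto simp: dataset_size_def)

lemma sum_B: "(\<Sum>x\<in>D. real (B x)) = n"
  using n by (simp add: dataset_size_def)

lemma potential_nonneg:
  assumes "valid A" shows "potential A \<ge> 0"
proof -
  have "B x / n * ln (A x / n) \<le> 0" if x: "x \<in> D" for x
  proof -
    have "A x \<le> (\<Sum>x\<in>D. A x)"
      using assms x D by (intro member_le_sum) (auto simp: valid_def intro: less_imp_le)
    then have "ln (A x / n) \<le> 0"
      using assms x n(2) by (simp add: valid_def)
    then show ?thesis by (intro mult_nonneg_nonpos) auto
  qed
  then show ?thesis by (simp add: potential_def sum_nonpos)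
qed

lemma valid_init: "valid (mwem_init D n)"
  using D D_nonempty n(2) by (auto simp: valid_def mwem_init_def card_gt_0_iff)

lemma potential_init: "potential (mwem_init D n) = ln (card D)"
proof -
  have "potential (mwem_init D n) = - (\<Sum>x\<in>D. B x / n * ln (1 / card D))"
    using n(2) by (simp add: potential_def mwem_init_def)
  also have "\<dots> = - ((\<Sum>x\<in>D. real (B x)) / n * ln (1 / card D))"
    by (simp add: sum_distrib_right sum_divide_distrib)
  also have "\<dots> = ln (card D)"
    using n(2) D D_nonempty by (simp add: sum_B ln_div card_gt_0_iff)
  finally show ?thesis .
qed

text \<open>The potential drops by \<open>\<eta> * Bval q / n\<close> minus the logarithm of the
  normaliser. Hoeffding's lemma bounds that logarithm by
  \<open>\<eta> * qval q A / n + \<eta>^2 / 2\<close>, leaving a drop of at least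
  \<open>\<eta> * d / n - \<eta>^2 / 2\<close>.\<close>

lemma update_progress:
  fixes z :: real
  assumes A: "valid A" and q: "q \<in> Q"
  defines "A' \<equiv> mwem_update D n A q (Bval q + z)"
  shows "valid A'" and "(err A q)\<^sup>2 \<le> 4 * (real n)\<^sup>2 * (potential A - potential A') + z\<^sup>2"
proof -
  \<comment> \<open>\<open>d\<close> is the signed error of \<open>q\<close>; the measurement minus
    \<open>qval q A\<close> is \<open>d + z\<close>, so \<open>\<eta>\<close> is the coefficient of
    \<open>q x\<close> in the update.\<close>
  define d \<eta> where "d = Bval q - qval q A" and "\<eta> = (d + z) / (2 * n)"
  define w where "w = (\<lambda>x. A x * exp (\<eta> * q x))"
  have A': "A' = (\<lambda>x\<in>D. n * (w x / sum w D))"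
    by (simp add: A'_def mwem_update_def Let_def w_def \<eta>_def d_def algebra_simps)
  have Apos: "A x > 0" if "x \<in> D" for x using A that by (simp add: valid_def)
  have w: "w x > 0" if "x \<in> D" for x using Apos[OF that] by (simp add: w_def)
  have W: "sum w D > 0" using w D D_nonempty by (intro sum_pos) auto
  have qx: "q x \<in> {-1..1}" if "x \<in> D" for x
    using PiE_mem[of q D "\<lambda>_. {-1..1}" x] Q(3) q that by blast
  show "valid A'"
    using w W n(2) by (auto simp: valid_def A' simp flip: sum_distrib_left sum_divide_distrib)
  have "(\<Sum>x\<in>D. A x / n * exp (\<eta> * q x)) \<le> exp (\<eta> * (\<Sum>x\<in>D. A x / n * q x) + \<eta>\<^sup>2 / 2)"
    using A D qx n(2) by (intro hoeffding_weighted_exp) (auto simp: valid_def less_imp_le simp flip: sum_divide_distrib)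
  moreover have "(\<Sum>x\<in>D. A x / n * q x) = qval q A / n"
    by (simp add: query_value_def sum_divide_distrib mult_ac)
  moreover have "(\<Sum>x\<in>D. A x / n * exp (\<eta> * q x)) = sum w D / n"
    by (simp add: w_def sum_divide_distrib)
  ultimately have "sum w D / n \<le> exp (\<eta> * qval q A / n + \<eta>\<^sup>2 / 2)"
    by simp
  then have "ln (sum w D / n) \<le> ln (exp (\<eta> * qval q A / n + \<eta>\<^sup>2 / 2))"
    using W n(2) by (intro ln_mono) auto
  then have lnW: "ln (sum w D / n) \<le> \<eta> * qval q A / n + \<eta>\<^sup>2 / 2" by simp
  have ln_ratio: "ln (A' x / n) - ln (A x / n) = \<eta> * q x - ln (sum w D / n)" if x: "x \<in> D" for x
    using W n(2) w[OF x] Apos[OF x] x by (simp add: A' ln_div w_def ln_mult)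
  have "potential A - potential A' = (\<Sum>x\<in>D. B x / n * (ln (A' x / n) - ln (A x / n)))"
    by (simp add: potential_def right_diff_distrib sum_subtractf)
  also have "\<dots> = (\<Sum>x\<in>D. B x / n * (\<eta> * q x - ln (sum w D / n)))"
    by (simp add: ln_ratio)
  also have "\<dots> = \<eta> * (\<Sum>x\<in>D. q x * B x) / n - (\<Sum>x\<in>D. real (B x)) / n * ln (sum w D / n)"
    by (simp add: right_diff_distrib sum_subtractf sum_distrib_left sum_distrib_right sum_divide_distrib mult_ac)
  also have "\<dots> = \<eta> * Bval q / n - ln (sum w D / n)"
    using n(2) by (simp add: sum_B query_value_def)
  also have "\<dots> \<ge> \<eta> * d / n - \<eta>\<^sup>2 / 2"
    using lnW by (simp add: d_def right_diff_distrib diff_divide_distrib)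
  finally have "4 * (real n)\<^sup>2 * (\<eta> * d / n - \<eta>\<^sup>2 / 2) \<le> 4 * (real n)\<^sup>2 * (potential A - potential A')"
    by (intro mult_left_mono) auto
  \<comment> \<open>Completing the square isolates \<open>d^2 - z^2\<close>; the remaining square is
    nonnegative and is discarded.\<close>
  moreover have "4 * (real n)\<^sup>2 * (\<eta> * d / n - \<eta>\<^sup>2 / 2) = d\<^sup>2 - z\<^sup>2 + (d + z)\<^sup>2 / 2"
    using n(2) by (simp add: \<eta>_def field_simps power2_eq_square)
  ultimately have "d\<^sup>2 \<le> 4 * (real n)\<^sup>2 * (potential A - potential A') + z\<^sup>2"
    using zero_le_power2[of "d + z"] by linarith
  then show "(err A q)\<^sup>2 \<le> 4 * (real n)\<^sup>2 * (potential A - potential A') + z\<^sup>2"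
    by (simp add: mwem_score_def d_def power2_commute)
qed

section \<open>Good histories and their measurability\<close>

text \<open>This is the Laplace scale times \<open>ln (card Q)\<close>, which makes the tail
  probability exactly \<open>1 / card Q\<close>.\<close>

definition noise_bound :: real where
  "noise_bound = 2 * real T * ln (real (card Q)) / \<epsilon>"

text \<open>
  The drawn query and noise are not part of the history, and their existence is not obviously a
  measurable condition on the weightings; only this measurable consequence is tracked.
\<close>

definition good_step :: "('a \<Rightarrow> real) \<Rightarrow> ('a \<Rightarrow> real) \<Rightarrow> bool" where
  "good_step A A' \<longleftrightarrow> (\<exists>q\<in>Q. (\<forall>q'\<in>Q. err A q' \<le> err A q + 4 * noise_bound) \<and>
     (err A q)\<^sup>2 \<le> 4 * (real n)\<^sup>2 * (potential A - potential A') + noise_bound\<^sup>2)"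

text \<open>The initial potential is recorded for the telescoping sum. Validity of the latest
  weighting is what the next update relies on, and at the end it makes the last potential
  nonnegative.\<close>

definition good :: "nat \<Rightarrow> (nat \<Rightarrow> 'a \<Rightarrow> real) \<Rightarrow> bool" where
  "good i H \<longleftrightarrow> potential (H 0) = ln (card D) \<and> valid (H i) \<and> (\<forall>j<i. good_step (H j) (H (Suc j)))"

definition bad :: "nat \<Rightarrow> (nat \<Rightarrow> 'a \<Rightarrow> real) set" where
  "bad i = {H \<in> space (history_space D i). \<not> good i H}"

lemma card_Q: "real (card Q) \<ge> 1"
  using Q by (simp add: Suc_le_eq card_gt_0_iff)

lemma noise_bound_nonneg: "noise_bound \<ge> 0"
  using card_Q \<epsilon> by (simp add: noise_bound_def)

text \<open>All conditions compare real functions of the coordinates \<open>H j x\<close>, and the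
  quantifiers range over the finite sets \<open>D\<close>, \<open>Q\<close> and the rounds below
  \<open>i\<close>.\<close>

lemma measurable_good: "Measurable.pred (history_space D i) (good i)"
proof -
  have val: "(\<lambda>H. H j x) \<in> borel_measurable (history_space D i)" if "j \<le> i" "x \<in> D" for j x
    using that by (intro measurable_compose[where N="weighting_space D" and f="\<lambda>H. H j" and g="\<lambda>a. a x"]
      measurable_component_singleton) auto
  have pot: "(\<lambda>H. potential (H j)) \<in> borel_measurable (history_space D i)" if "j \<le> i" for j
    unfolding potential_def using val[OF that] by measurable
  have err: "(\<lambda>H. err (H j) q) \<in> borel_measurable (history_space D i)" if "j \<le> i" for j q
    unfolding mwem_score_def query_value_def using val[OF that] by measurable
  have [measurable]: "Measurable.pred (history_space D i) (\<lambda>H. valid (H i))"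
  proof -
    have [measurable]: "(\<lambda>H. sum (H i) D) \<in> borel_measurable (history_space D i)"
      using borel_measurable_sum[of D "\<lambda>x H. H i x", OF val[OF order_refl]] by simp
    have [measurable]: "Measurable.pred (history_space D i) (\<lambda>H. \<forall>x\<in>D. 0 < H i x)"
      using val[OF order_refl] by (intro pred_intros_finite D) measurable
    have [measurable]: "Measurable.pred (history_space D i) (\<lambda>H. sum (H i) D = real n)"
      unfolding pred_def by (intro borel_measurable_eq) measurable
    show ?thesis
      unfolding valid_def by (intro pred_intros_logic) fact+
  qed
  have [measurable]: "Measurable.pred (history_space D i) (\<lambda>H. good_step (H j) (H (Suc j)))" if "j < i" for j
  proof -
    have [measurable]: "\<And>q. (\<lambda>H. err (H j) q) \<in> borel_measurable (history_space D i)"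
      using err[of j] that by simp
    have [measurable]: "(\<lambda>H. potential (H j)) \<in> borel_measurable (history_space D i)"
      "(\<lambda>H. potential (H (Suc j))) \<in> borel_measurable (history_space D i)"
      using pot[of j] pot[of "Suc j"] that by simp_all
    have "Measurable.pred (history_space D i) (\<lambda>H. err (H j) q' \<le> err (H j) q + 4 * noise_bound)" for q q'
      unfolding pred_def by (intro borel_measurable_le) measurable
    moreover have "Measurable.pred (history_space D i) (\<lambda>H. (err (H j) q)\<^sup>2
        \<le> 4 * (real n)\<^sup>2 * (potential (H j) - potential (H (Suc j))) + noise_bound\<^sup>2)" for q
      unfolding pred_def by (intro borel_measurable_le) measurable
    ultimately show ?thesis
      unfolding good_step_def by (intro pred_intros_logic pred_intros_finite Q)
  qed
  have [measurable]: "(\<lambda>H. potential (H 0)) \<in> borel_measurable (history_space D i)" by (rule pot) simp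
  show ?thesis unfolding good_def by measurable
qed

lemma sets_bad: "bad i \<in> sets (history_space D i)"
  unfolding bad_def using measurable_good[of i] by measurable

text \<open>The deterministic half of a round. Entries up to \<open>i\<close> are untouched, so only
  the newest step is checked, with the drawn query as witness.\<close>

lemma good_Suc:
  assumes H: "good i H" and q: "q \<in> Q" "\<And>q'. q' \<in> Q \<Longrightarrow> err (H i) q' \<le> err (H i) q + 4 * noise_bound"
    and z: "\<bar>z\<bar> \<le> noise_bound"
  shows "good (Suc i) (H(Suc i := mwem_update D n (H i) q (Bval q + z)))"
proof -
  have "valid (H i)" using H by (simp add: good_def)
  note u = update_progress[OF this q(1), of z]
  have "z\<^sup>2 \<le> noise_bound\<^sup>2"
    using power_mono[OF z, of 2] by simp
  with u(2) q have "good_step (H i) (mwem_update D n (H i) q (Bval q + z))"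
    unfolding good_step_def by (intro bexI[of _ q]) auto
  with H u(1) show ?thesis by (auto simp: good_def less_Suc_eq)
qed

section \<open>Failure probability, accumulated over the rounds\<close>

text \<open>By \<open>good_Suc\<close>, a round can fail only through a poor query or large noise;
  each has probability at most \<open>1 / card Q\<close>.\<close>

lemma round_bad:
  assumes H: "H \<in> space (history_space D i)" "good i H"
  shows "emeasure (do {
       q \<leftarrow> exponential_mechanism (\<epsilon> / (2 * real T)) (mwem_score D (H i)) Q B;
       z \<leftarrow> laplace_measure (2 * real T / \<epsilon>);
       return (history_space D (Suc i)) (H(Suc i := mwem_update D n (H i) q (Bval q + z)))
     }) (bad (Suc i)) \<le> ennreal (2 / card Q)"
proof -
  let ?L = "laplace_measure (2 * real T / \<epsilon>)"
  let ?E = "exponential_mechanism (\<epsilon> / (2 * real T)) (mwem_score D (H i)) Q B"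
  let ?S = "history_space D (Suc i)"
  let ?f = "\<lambda>q z. H(Suc i := mwem_update D n (H i) q (Bval q + z))"
  let ?Y = "{q \<in> Q. \<exists>q'\<in>Q. err (H i) q' > err (H i) q + 4 * noise_bound}"
  interpret L: prob_space ?L using T \<epsilon> by (intro prob_space_laplace_measure) auto
  have sL[measurable_cong]: "sets ?L = sets borel" by (simp add: laplace_measure_def)
  have sE: "sets ?E = sets (count_space Q)" by (simp add: exponential_mechanism_def sets_point_measure)
  then have spE: "space ?E = Q" by (simp add: exponential_mechanism_def space_point_measure)
  have f: "?f q \<in> ?L \<rightarrow>\<^sub>M ?S" for q
  proof (rule measurable_fun_upd[where J="{..i}"])
    show "(\<lambda>z. mwem_update D n (H i) q (Bval q + z)) \<in> ?L \<rightarrow>\<^sub>M weighting_space D"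
      unfolding mwem_update_def Let_def by (intro measurable_restrict) measurable
  qed (use H in \<open>auto intro: measurable_const\<close>)
  have distr: "?L \<bind> (\<lambda>z. return ?S (?f q z)) = distr ?L ?S (?f q)" for q
    by (rule bind_return_distr'[OF L.not_empty f])
  have "emeasure ?E ?Y \<le> ennreal (card Q * exp (- (\<epsilon> / (2 * real T)) * (4 * noise_bound) / 2))"
    using exponential_mechanism_bad[OF Q(1,2), of "\<epsilon> / (2 * real T)" "mwem_score D (H i)" B "4 * noise_bound"] T \<epsilon>
    by simp
  \<comment> \<open>The slack of 4 noise bounds makes each poor query at most
    \<open>1 / (card Q)^2\<close> likely; one factor pays for the union bound over
    \<open>Q\<close>.\<close>
  also have "- (\<epsilon> / (2 * real T)) * (4 * noise_bound) / 2 = - ln (card Q) + - ln (card Q)"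
    using T \<epsilon> by (simp add: noise_bound_def)
  also have "card Q * exp (- ln (card Q) + - ln (card Q)) = 1 / card Q"
    using card_Q unfolding exp_add by (simp add: exp_minus inverse_eq_divide)
  finally have selection: "emeasure ?E ?Y \<le> ennreal (1 / card Q)" .
  have "emeasure (?E \<bind> (\<lambda>q. distr ?L ?S (?f q))) (bad (Suc i)) \<le> emeasure ?E ?Y + ennreal (1 / card Q)"
  proof (rule emeasure_bind_le)
    show "prob_space ?E" by (rule prob_space_exponential_mechanism[OF Q(1,2)])
    \<comment> \<open>On the discrete space \<open>Q\<close> it is enough that each value is a
      subprobability measure.\<close>
    show "(\<lambda>q. distr ?L ?S (?f q)) \<in> ?E \<rightarrow>\<^sub>M subprob_algebra ?S"
      unfolding measurable_cong_sets[OF sE refl]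
      by (auto simp: space_subprob_algebra intro!: prob_space_imp_subprob_space L.prob_space_distr f)
    show "bad (Suc i) \<in> sets ?S" by (rule sets_bad)
    show "?Y \<in> sets ?E" by (auto simp: sE)
    fix q assume "q \<in> space ?E" "q \<notin> ?Y"
    then have q: "q \<in> Q" "\<And>q'. q' \<in> Q \<Longrightarrow> err (H i) q' \<le> err (H i) q + 4 * noise_bound"
      by (auto simp: spE not_less)
    have "emeasure (distr ?L ?S (?f q)) (bad (Suc i)) = emeasure ?L (?f q -` bad (Suc i) \<inter> space ?L)"
      by (rule emeasure_distr[OF f sets_bad])
    also have "\<dots> \<le> emeasure ?L {z. \<bar>z\<bar> > noise_bound}"
    proof (rule emeasure_mono)
      \<comment> \<open>Contrapositive of \<open>good_Suc\<close>: after an adequate query, only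
        large noise leads to a bad history.\<close>
      show "?f q -` bad (Suc i) \<inter> space ?L \<subseteq> {z. \<bar>z\<bar> > noise_bound}"
        using good_Suc[OF H(2) q] by (force simp: bad_def not_le[symmetric])
    qed simp
    also have "\<dots> = ennreal (exp (- noise_bound / (2 * real T / \<epsilon>)))"
      using T \<epsilon> noise_bound_nonneg by (intro laplace_tail) auto
    also have "- noise_bound / (2 * real T / \<epsilon>) = - ln (card Q)"
      using T \<epsilon> by (simp add: noise_bound_def)
    also have "exp (- ln (card Q)) = 1 / card Q"
      using card_Q by (simp add: exp_minus inverse_eq_divide)
    finally show "emeasure (distr ?L ?S (?f q)) (bad (Suc i)) \<le> ennreal (1 / card Q)" .
  qed
  also have "\<dots> \<le> ennreal (1 / card Q) + ennreal (1 / card Q)"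
    by (intro add_right_mono selection)
  also have "ennreal (1 / card Q) + ennreal (1 / card Q) = ennreal (2 / card Q)"
    by (subst ennreal_plus[symmetric]) auto
  finally show ?thesis
    unfolding distr .
qed

text \<open>The start is deterministic and good. Each further round adds at most
  \<open>2 / card Q\<close>, since already bad histories are charged in full to the induction
  hypothesis.\<close>

lemma history_bad:
  "emeasure (mwem_history D Q B T \<epsilon> i) (bad i) \<le> ennreal (i * (2 / card Q))"
proof (induction i)
  case 0
  have "good 0 (\<lambda>j\<in>{..0}. mwem_init D n)"
    using valid_init potential_init by (simp add: good_def)
  then show ?case
    using sets_bad[of 0] by (simp add: bad_def flip: n(1))
next
  case (Suc i)
  note wf = mwem_history_wf[OF D Q(1,2) T \<epsilon>, of B i]
  then have sets: "sets (mwem_history D Q B T \<epsilon> i) = sets (history_space D i)" by simp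
  have b: "2 * real T / \<epsilon> > 0" using T \<epsilon> by simp
  have "emeasure (mwem_history D Q B T \<epsilon> (Suc i)) (bad (Suc i))
      \<le> emeasure (mwem_history D Q B T \<epsilon> i) (bad i) + ennreal (2 / card Q)"
    unfolding mwem_history.simps
  proof (rule emeasure_bind_le)
    show "prob_space (mwem_history D Q B T \<epsilon> i)" using wf by simp
    show "bad (Suc i) \<in> sets (history_space D (Suc i))" "bad i \<in> sets (mwem_history D Q B T \<epsilon> i)"
      by (simp_all add: sets sets_bad)
  next
    fix H assume "H \<in> space (mwem_history D Q B T \<epsilon> i)" "H \<notin> bad i"
    then have "H \<in> space (history_space D i)" "good i H"
      by (auto simp: bad_def sets_eq_imp_space_eq[OF sets])
    from round_bad[OF this] show "emeasure (do {
       q \<leftarrow> exponential_mechanism (\<epsilon> / (2 * real T)) (mwem_score D (H i)) Q B;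
       z \<leftarrow> laplace_measure (2 * real T / \<epsilon>);
       return (history_space D (Suc i))
         (H(Suc i := mwem_update D (real (dataset_size D B)) (H i) q (Bval q + z)))
     }) (bad (Suc i)) \<le> ennreal (2 / card Q)" by (simp flip: n(1))
  qed (unfold measurable_cong_sets[OF sets refl], rule measurable_mwem_round(1)[OF D Q(1,2) b])
  also have "\<dots> \<le> ennreal (i * (2 / card Q)) + ennreal (2 / card Q)"
    by (intro add_right_mono Suc.IH)
  also have "\<dots> = ennreal (Suc i * (2 / card Q))"
    by (simp add: algebra_simps add_divide_distrib flip: ennreal_plus)
  finally show ?case .
qed

section \<open>Accuracy of the average along a good history\<close>

text \<open>By linearity and the triangle inequality, the error of the average is at most the mean
  error of the \<open>H i\<close>. Of the 5 noise bounds, 4 come from suboptimal selection and 1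
  from the noise term in the potential drop.\<close>

lemma good_imp_accurate:
  assumes H: "good T H" and q: "q \<in> Q"
  shows "\<bar>qval q (\<lambda>x\<in>D. (1 / real T) * (\<Sum>i<T. H i x)) - Bval q\<bar>
    \<le> 2 * real n * sqrt (ln (card D) / real T) + 5 * noise_bound"
proof -
  have "\<forall>j<T. good_step (H j) (H (Suc j))" using H by (simp add: good_def)
  \<comment> \<open>The \<open>u j\<close> are witnesses from \<open>good_step\<close> and may
    differ from the queries actually drawn.\<close>
  then obtain u where u: "\<And>j q'. j < T \<Longrightarrow> q' \<in> Q \<Longrightarrow> err (H j) q' \<le> err (H j) (u j) + 4 * noise_bound"
    "\<And>j. j < T \<Longrightarrow> (err (H j) (u j))\<^sup>2 \<le> 4 * (real n)\<^sup>2 * (potential (H j) - potential (H (Suc j))) + noise_bound\<^sup>2"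
    unfolding good_step_def by metis
  define e where "e j = err (H j) (u j)" for j
  define s where "s = sqrt (ln (card D) / real T)"
  have lnD: "ln (card D) \<ge> 0"
    using D D_nonempty by (simp add: Suc_le_eq card_gt_0_iff)
  have s: "s \<ge> 0" "s\<^sup>2 = ln (card D) / real T"
    using lnD by (simp_all add: s_def)
  have lnD_eq: "ln (card D) = s\<^sup>2 * T"
    using s(2) T by simp
  \<comment> \<open>Cauchy-Schwarz against the constant 1.\<close>
  have "(\<Sum>j<T. e j)\<^sup>2 \<le> T * (\<Sum>j<T. (e j)\<^sup>2)"
    using sum_squared_le_sum_of_squares[of e "{..<T}"] by (simp add: mult.commute)
  also have "(\<Sum>j<T. (e j)\<^sup>2) \<le> (\<Sum>j<T. 4 * (real n)\<^sup>2 * (potential (H j) - potential (H (Suc j))) + noise_bound\<^sup>2)"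
    using u(2) by (intro sum_mono) (simp add: e_def)
  also have "\<dots> = 4 * (real n)\<^sup>2 * (potential (H 0) - potential (H T)) + T * noise_bound\<^sup>2"
    by (simp add: sum.distrib sum_lessThan_telescope'[of "\<lambda>j. potential (H j)"] flip: sum_distrib_left)
  \<comment> \<open>The \<open>T\<close> steps start from exactly the averaged weightings
    \<open>H 0\<close> to \<open>H (T - 1)\<close>; \<open>H T\<close> enters only through its
    nonnegative potential.\<close>
  also have "\<dots> \<le> 4 * (real n)\<^sup>2 * ln (card D) + T * noise_bound\<^sup>2"
    using H potential_nonneg[of "H T"] by (intro add_right_mono mult_left_mono) (auto simp: good_def)
  also have "T * \<dots> = T\<^sup>2 * ((2 * n * s)\<^sup>2 + noise_bound\<^sup>2)"
    unfolding lnD_eq by (simp add: algebra_simps power2_eq_square)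
  \<comment> \<open>For nonnegative terms a sum of squares is at most the square of the sum.\<close>
  also have "\<dots> \<le> T\<^sup>2 * (2 * n * s + noise_bound)\<^sup>2"
    using s noise_bound_nonneg by (intro mult_left_mono) (auto simp: power2_sum)
  finally have "(\<Sum>j<T. e j)\<^sup>2 \<le> (T * (2 * n * s + noise_bound))\<^sup>2"
    by (simp add: power_mult_distrib mult_left_mono)
  then have sum_e: "(\<Sum>j<T. e j) \<le> T * (2 * n * s + noise_bound)"
    by (rule power2_le_imp_le) (use s(1) noise_bound_nonneg in simp)
  have "qval q (\<lambda>x\<in>D. (1 / real T) * (\<Sum>i<T. H i x)) = (\<Sum>i<T. qval q (H i)) / T"
    unfolding query_value_def by (subst sum.swap) (simp add: sum_distrib_left sum_divide_distrib)
  also have "\<dots> - Bval q = (\<Sum>i<T. qval q (H i) - Bval q) / T"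
    using T by (simp add: sum_subtractf field_simps)
  finally have "\<bar>qval q (\<lambda>x\<in>D. (1 / real T) * (\<Sum>i<T. H i x)) - Bval q\<bar> = \<bar>\<Sum>i<T. qval q (H i) - Bval q\<bar> / T"
    by simp
  also have "\<dots> \<le> (\<Sum>i<T. err (H i) q) / T"
    unfolding mwem_score_def by (intro divide_right_mono sum_abs) auto
  also have "\<dots> \<le> (\<Sum>i<T. e i + 4 * noise_bound) / T"
    using u(1) q by (intro divide_right_mono sum_mono) (auto simp: e_def)
  also have "\<dots> \<le> (T * (2 * n * s + noise_bound) + T * (4 * noise_bound)) / T"
    using sum_e by (intro divide_right_mono) (auto simp: sum.distrib)
  also have "\<dots> = 2 * n * s + 5 * noise_bound"
    using T by (simp add: field_simps)
  finally show ?thesis by (simp add: s_def)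
qed

end

section \<open>Transfer from histories to the law of the output\<close>

theorem theorem2:
  fixes D :: "'a set" and Q :: "('a \<Rightarrow> real) set" and B :: "'a \<Rightarrow> nat"
    and n T :: nat and \<epsilon> :: real
  assumes "finite D"
    and "finite Q" and "Q \<noteq> {}" and "Q \<subseteq> D \<rightarrow>\<^sub>E {-1..1}"
    and "n = dataset_size D B" and "n > 0"
    and "T > 0" and "\<epsilon> > 0"
  shows "measure (mwem D Q B T \<epsilon>)
           {A \<in> space (mwem D Q B T \<epsilon>).
              Max ((\<lambda>q. \<bar>query_value D q A - query_value D q (\<lambda>x. real (B x))\<bar>) ` Q)
                \<le> 2 * real n * sqrt (ln (real (card D)) / real T)
                   + 10 * real T * ln (real (card Q)) / \<epsilon>}
         \<ge> 1 - 2 * real T / real (card Q)"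
proof -
  interpret mwem_run D Q B n T \<epsilon>
    using assms by unfold_locales auto
  let ?H = "mwem_history D Q B T \<epsilon> T" and ?W = "weighting_space D"
  let ?avg = "\<lambda>A. \<lambda>x\<in>D. (1 / real T) * (\<Sum>i<T. A i x)"
  let ?b = "2 * real n * sqrt (ln (real (card D)) / real T) + 10 * real T * ln (real (card Q)) / \<epsilon>"
  \<comment> \<open>The bound on the maximum is stated as a finite conjunction, for which
    measurability is direct; the two agree as \<open>Q\<close> is finite and nonempty.\<close>
  let ?G = "{A \<in> space ?W. \<forall>q\<in>Q. \<bar>qval q A - Bval q\<bar> \<le> ?b}"
  note wf = mwem_history_wf[OF D Q(1,2) T \<epsilon>, of B T]
  then have sets: "sets ?H = sets (history_space D T)" by simp
  note space = sets_eq_imp_space_eq[OF sets]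
  interpret H: prob_space ?H using wf by simp
  have [measurable]: "(\<lambda>A. A i x) \<in> borel_measurable (history_space D T)" if "x \<in> D" "i < T" for x i
    using that by (intro measurable_compose[where N="weighting_space D" and f="\<lambda>A. A i" and g="\<lambda>a. a x"]
      measurable_component_singleton) auto
  have avg: "?avg \<in> ?H \<rightarrow>\<^sub>M ?W"
    unfolding measurable_cong_sets[OF sets refl] by measurable
  have "Measurable.pred ?W (\<lambda>A. \<bar>qval q A - Bval q\<bar> \<le> ?b)" for q
    unfolding query_value_def by measurable
  then have "Measurable.pred ?W (\<lambda>A. \<forall>q\<in>Q. \<bar>qval q A - Bval q\<bar> \<le> ?b)"
    by (intro pred_intros_finite Q)
  then have G: "?G \<in> sets ?W" by measurable
  have b: "?b = 2 * real n * sqrt (ln (real (card D)) / real T) + 5 * noise_bound"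
    by (simp add: noise_bound_def)
  have "1 - 2 * real T / real (card Q) \<le> 1 - H.prob (bad T)"
    using history_bad[of T] card_Q by (simp add: H.emeasure_eq_measure mult_ac)
  also have "\<dots> = H.prob (space ?H - bad T)"
    by (rule H.prob_compl[symmetric]) (simp add: sets sets_bad)
  also have "\<dots> \<le> H.prob (?avg -` ?G \<inter> space ?H)"
  proof (rule H.finite_measure_mono)
    show "space ?H - bad T \<subseteq> ?avg -` ?G \<inter> space ?H"
    proof
      fix A assume A: "A \<in> space ?H - bad T"
      then have "good T A" by (auto simp: bad_def space)
      from good_imp_accurate[OF this] A measurable_space[OF avg] show "A \<in> ?avg -` ?G \<inter> space ?H"
        unfolding b by auto
    qed
  qed (use measurable_sets[OF avg G] in simp)
  \<comment> \<open>The output law is the image of the history law under averaging.\<close>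
  also have "\<dots> = measure (mwem D Q B T \<epsilon>) ?G"
    unfolding mwem_def by (rule measure_distr[OF avg G, symmetric])
  also have "?G = {A \<in> space (mwem D Q B T \<epsilon>). Max ((\<lambda>q. \<bar>qval q A - Bval q\<bar>) ` Q) \<le> ?b}"
    using Q by (simp add: mwem_def)
  finally show ?thesis .
qed

end
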